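(* Let $G$ be a finitely generated nilpotent group with finite symmetric generating set $S$, and let $\mu$ be an adapted, smooth probability measure on $G$ which is Abelian-centered, i.e. $\sum_{g\in G}\mu(g)[g]=0$ in $G_{\mathrm{ab}}\otimes_{\mathbb Z}\mathbb R$. Then the map $$\Theta:\mathrm{LHF}(G,\mu)/\mathbb C\longrightarrow \mathrm{Hom}(G_{\mathrm{ab}},\mathbb C),\qquad \Theta([f])(s):=\partial^s f(e)=f(s)-f(e),$$ (that is, $\Theta([f])$ is the homomorphism whose value at the class of $s$ is $f(s)-f(e)$) is a well-defined linear isometry, where the left-hand side carries the Lipschitz seminorm $\|\nabla_S f\|_\infty$ and the right-hand side carries the norm $\|\varphi\|_S=\max_{s\in S}|\varphi([s])|$, and it is bijective with inverse $\varphi\mapsto [x\mapsto\varphi([x])]$.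
   Context: $|x|$ is the word length with respect to $S$. $G_{\mathrm{ab}}=G/[G,G]$ and $[x]$ is the class of $x\in G$ in $G_{\mathrm{ab}}$ (or its image in $G_{\mathrm{ab}}\otimes_{\mathbb Z}\mathbb R$). A probability measure $\mu$ on $G$ is adapted if the semigroup generated by $\mathrm{supp}(\mu)$ is $G$; it is smooth if there is $\zeta>0$ with $\sum_{x}\mu(x)e^{\zeta|x|}<\infty$. A function $f:G\to\mathbb C$ is $\mu$-harmonic if for all $k\in G$, $f(k)=\sum_{g}\mu(g)f(kg)$ with absolute convergence. $\partial^s f(x)=f(xs)-f(x)$ and $\|\nabla_S f\|_\infty=\sup_{s\in S}\sup_{x\in G}|\partial^s f(x)|$; $f$ is Lipschitz if this is finite. $\mathrm{LHF}(G,\mu)$ is the vector space of Lipschitz $\mu$-harmonic functions $G\to\mathbb C$, and $\mathrm{LHF}(G,\mu)/\mathbb C$ is its quotient by the constant functions. *)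

theory Defs
  imports
    "HOL-Probability.Probability"
    "HOL-Algebra.Generated_Groups"
    "HOL-Algebra.Free_Abelian_Groups"
begin

subsection \<open>Finitely generated nilpotent groups\<close>

fun lower_central :: "('a, 'b) monoid_scheme \<Rightarrow> nat \<Rightarrow> 'a set" where
  "lower_central G 0 = carrier G"
| "lower_central G (Suc n) = generate G
     {x \<otimes>\<^bsub>G\<^esub> y \<otimes>\<^bsub>G\<^esub> inv\<^bsub>G\<^esub> x \<otimes>\<^bsub>G\<^esub> inv\<^bsub>G\<^esub> y | x y. x \<in> lower_central G n \<and> y \<in> carrier G}"

definition nilpotent_group :: "('a, 'b) monoid_scheme \<Rightarrow> bool" where
  "nilpotent_group G \<longleftrightarrow> group G \<and> (\<exists>n. lower_central G n = {\<one>\<^bsub>G\<^esub>})"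

definition finite_symmetric_generating_set :: "('a, 'b) monoid_scheme \<Rightarrow> 'a set \<Rightarrow> bool" where
  "finite_symmetric_generating_set G S \<longleftrightarrow>
     finite S \<and> S \<subseteq> carrier G \<and> (\<forall>s\<in>S. inv\<^bsub>G\<^esub> s \<in> S) \<and> generate G S = carrier G"

definition word_length :: "('a, 'b) monoid_scheme \<Rightarrow> 'a set \<Rightarrow> 'a \<Rightarrow> nat" where
  "word_length G S x =
     (LEAST n. \<exists>ws. set ws \<subseteq> S \<and> length ws = n \<and> foldr (\<otimes>\<^bsub>G\<^esub>) ws \<one>\<^bsub>G\<^esub> = x)"

definition abelianization :: "('a, 'b) monoid_scheme \<Rightarrow> 'a set monoid" where
  "abelianization G = G Mod (derived G (carrier G))"

definition ab_class :: "('a, 'b) monoid_scheme \<Rightarrow> 'a \<Rightarrow> 'a set" where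
  "ab_class G x = derived G (carrier G) #>\<^bsub>G\<^esub> x"

definition plus_group :: "'a::ab_group_add monoid" where
  "plus_group = \<lparr>carrier = UNIV, monoid.mult = (+), one = 0\<rparr>"

subsection \<open>The real vector space \<open>A \<otimes> \<real>\<close> of an abelian group \<open>A\<close>\<close>

text \<open>
  The tensor product over the integers of a multiplicatively written abelian group \<open>A\<close> with the
  additive group of the reals: the free abelian group on pairs \<open>(a, r)\<close> modulo the biadditivity
  relations. Scalars act by \<open>r \<cdot> (a \<otimes> s) = a \<otimes> (r * s)\<close>.
\<close>

definition tensor_relations :: "('a, 'b) monoid_scheme \<Rightarrow> (('a \<times> real) \<Rightarrow>\<^sub>0 int) set" where
  "tensor_relations A = generate (free_Abelian_group (carrier A \<times> UNIV))
     ({frag_of (a \<otimes>\<^bsub>A\<^esub> b, r) - frag_of (a, r) - frag_of (b, r) | a b r.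
         a \<in> carrier A \<and> b \<in> carrier A} \<union>
      {frag_of (a, r + s) - frag_of (a, r) - frag_of (a, s) | a r s. a \<in> carrier A})"

definition real_tensor :: "('a, 'b) monoid_scheme \<Rightarrow> (('a \<times> real) \<Rightarrow>\<^sub>0 int) set monoid" where
  "real_tensor A = free_Abelian_group (carrier A \<times> UNIV) Mod tensor_relations A"

definition pure_tensor ::
    "('a, 'b) monoid_scheme \<Rightarrow> 'a \<Rightarrow> real \<Rightarrow> (('a \<times> real) \<Rightarrow>\<^sub>0 int) set" where
  "pure_tensor A a r =
     tensor_relations A #>\<^bsub>free_Abelian_group (carrier A \<times> UNIV)\<^esub> frag_of (a, r)"

text \<open>
  Real-linear functionals; since pure tensors generate, homogeneity is only required on them.
\<close>

definition real_tensor_dual ::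
    "('a, 'b) monoid_scheme \<Rightarrow> ((('a \<times> real) \<Rightarrow>\<^sub>0 int) set \<Rightarrow> real) set" where
  "real_tensor_dual A = {\<phi> \<in> hom (real_tensor A) plus_group.
     \<forall>a\<in>carrier A. \<forall>r s. \<phi> (pure_tensor A a (r * s)) = r * \<phi> (pure_tensor A a s)}"

text \<open>
  The coarsest topology making all linear functionals continuous. If \<open>A\<close> is finitely generated,
  \<open>A \<otimes> \<real>\<close> is finite-dimensional and this is its unique Hausdorff vector space topology.
\<close>

definition real_tensor_topology ::
    "('a, 'b) monoid_scheme \<Rightarrow> (('a \<times> real) \<Rightarrow>\<^sub>0 int) set topology" where
  "real_tensor_topology A = topology_generated_by
     {{t \<in> carrier (real_tensor A). \<phi> t \<in> U} | \<phi> U. \<phi> \<in> real_tensor_dual A \<and> open U}"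

subsection \<open>Measures\<close>

text \<open>
  A finitely generated group is countable, so its probability measures are the probability mass
  functions \<open>\<mu>\<close> with \<open>set_pmf \<mu> \<subseteq> carrier G\<close>; the support of \<open>\<mu>\<close> is \<open>set_pmf \<mu>\<close>.
\<close>

inductive_set semigroup_generated :: "('a, 'b) monoid_scheme \<Rightarrow> 'a set \<Rightarrow> 'a set"
  for G and A where
  incl: "a \<in> A \<Longrightarrow> a \<in> semigroup_generated G A"
| mult: "x \<in> semigroup_generated G A \<Longrightarrow> y \<in> semigroup_generated G A \<Longrightarrow>
           x \<otimes>\<^bsub>G\<^esub> y \<in> semigroup_generated G A"

definition adapted :: "('a, 'b) monoid_scheme \<Rightarrow> 'a pmf \<Rightarrow> bool" where
  "adapted G \<mu> \<longleftrightarrow> semigroup_generated G (set_pmf \<mu>) = carrier G"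

definition smooth_measure :: "('a, 'b) monoid_scheme \<Rightarrow> 'a set \<Rightarrow> 'a pmf \<Rightarrow> bool" where
  "smooth_measure G S \<mu> \<longleftrightarrow>
     (\<exists>\<zeta>>0. (\<lambda>x. pmf \<mu> x * exp (\<zeta> * real (word_length G S x))) summable_on carrier G)"

text \<open>
  The term \<open>\<mu> g [g]\<close> is the pure tensor \<open>[g] \<otimes> \<mu> g\<close>; the series is the unordered sum, that is, the
  limit of its finite partial sums (\<open>finprod\<close>, since HOL-Algebra groups are multiplicative).
\<close>

definition abelian_centered :: "('a, 'b) monoid_scheme \<Rightarrow> 'a pmf \<Rightarrow> bool" where
  "abelian_centered G \<mu> \<longleftrightarrow>
     (let A = abelianization G in
      limitin (real_tensor_topology A)
        (finprod (real_tensor A) (\<lambda>g. pure_tensor A (ab_class G g) (pmf \<mu> g)))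
        \<one>\<^bsub>real_tensor A\<^esub>
        (finite_subsets_at_top (carrier G)))"

subsection \<open>Lipschitz harmonic functions\<close>

text \<open>
  Functions on a carrier are extensional (\<open>undefined\<close> outside the carrier), so that they are
  determined by their values on it.
\<close>

definition harmonic :: "('a, 'b) monoid_scheme \<Rightarrow> 'a pmf \<Rightarrow> ('a \<Rightarrow> complex) \<Rightarrow> bool" where
  "harmonic G \<mu> f \<longleftrightarrow> (\<forall>k\<in>carrier G.
     (\<lambda>g. cmod (of_real (pmf \<mu> g) * f (k \<otimes>\<^bsub>G\<^esub> g))) summable_on carrier G \<and>
     f k = (\<Sum>\<^sub>\<infinity>g\<in>carrier G. of_real (pmf \<mu> g) * f (k \<otimes>\<^bsub>G\<^esub> g)))"

definition partial_diff :: "('a, 'b) monoid_scheme \<Rightarrow> 'a \<Rightarrow> ('a \<Rightarrow> complex) \<Rightarrow> 'a \<Rightarrow> complex" where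
  "partial_diff G s f x = f (x \<otimes>\<^bsub>G\<^esub> s) - f x"

definition grad_norm :: "('a, 'b) monoid_scheme \<Rightarrow> 'a set \<Rightarrow> ('a \<Rightarrow> complex) \<Rightarrow> ennreal" where
  "grad_norm G S f = (SUP s\<in>S. SUP x\<in>carrier G. ennreal (cmod (partial_diff G s f x)))"

definition LHF :: "('a, 'b) monoid_scheme \<Rightarrow> 'a set \<Rightarrow> 'a pmf \<Rightarrow> ('a \<Rightarrow> complex) set" where
  "LHF G S \<mu> = {f \<in> carrier G \<rightarrow>\<^sub>E UNIV. grad_norm G S f < \<infinity> \<and> harmonic G \<mu> f}"

definition fun_add :: "'c set \<Rightarrow> ('c \<Rightarrow> complex) \<Rightarrow> ('c \<Rightarrow> complex) \<Rightarrow> 'c \<Rightarrow> complex" where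
  "fun_add X f g = (\<lambda>x\<in>X. f x + g x)"

definition fun_scale :: "'c set \<Rightarrow> complex \<Rightarrow> ('c \<Rightarrow> complex) \<Rightarrow> 'c \<Rightarrow> complex" where
  "fun_scale X c f = (\<lambda>x\<in>X. c * f x)"

definition LHF_class ::
    "('a, 'b) monoid_scheme \<Rightarrow> 'a set \<Rightarrow> 'a pmf \<Rightarrow> ('a \<Rightarrow> complex) \<Rightarrow> ('a \<Rightarrow> complex) set" where
  "LHF_class G S \<mu> f = {g \<in> LHF G S \<mu>. \<exists>c. \<forall>x\<in>carrier G. g x = f x + c}"

definition LHF_mod_const ::
    "('a, 'b) monoid_scheme \<Rightarrow> 'a set \<Rightarrow> 'a pmf \<Rightarrow> ('a \<Rightarrow> complex) set set" where
  "LHF_mod_const G S \<mu> = LHF_class G S \<mu> ` LHF G S \<mu>"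

text \<open>
  The vector space operations induced on the quotient. The classes united below coincide for all
  choices of representatives.
\<close>

definition class_add :: "('a, 'b) monoid_scheme \<Rightarrow> 'a set \<Rightarrow> 'a pmf \<Rightarrow>
    ('a \<Rightarrow> complex) set \<Rightarrow> ('a \<Rightarrow> complex) set \<Rightarrow> ('a \<Rightarrow> complex) set" where
  "class_add G S \<mu> C D = (\<Union>f\<in>C. \<Union>g\<in>D. LHF_class G S \<mu> (fun_add (carrier G) f g))"

definition class_scale :: "('a, 'b) monoid_scheme \<Rightarrow> 'a set \<Rightarrow> 'a pmf \<Rightarrow>
    complex \<Rightarrow> ('a \<Rightarrow> complex) set \<Rightarrow> ('a \<Rightarrow> complex) set" where
  "class_scale G S \<mu> c C = (\<Union>f\<in>C. LHF_class G S \<mu> (fun_scale (carrier G) c f))"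

subsection \<open>The map \<open>\<Theta>\<close>\<close>

definition ab_Hom :: "('a, 'b) monoid_scheme \<Rightarrow> ('a set \<Rightarrow> complex) set" where
  "ab_Hom G = hom (abelianization G) plus_group \<inter> extensional (carrier (abelianization G))"

text \<open>The inserted \<open>0\<close> only matters for \<open>S = {}\<close>, which is possible for the trivial group.\<close>

definition hom_norm :: "('a, 'b) monoid_scheme \<Rightarrow> 'a set \<Rightarrow> ('a set \<Rightarrow> complex) \<Rightarrow> real" where
  "hom_norm G S \<phi> = Max (insert 0 ((\<lambda>s. cmod (\<phi> (ab_class G s))) ` S))"

definition is_Theta_value :: "('a, 'b) monoid_scheme \<Rightarrow> 'a set \<Rightarrow>
    ('a \<Rightarrow> complex) set \<Rightarrow> ('a set \<Rightarrow> complex) \<Rightarrow> bool" where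
  "is_Theta_value G S C \<phi> \<longleftrightarrow> \<phi> \<in> ab_Hom G \<and>
     (\<forall>f\<in>C. \<forall>s\<in>S. \<phi> (ab_class G s) = partial_diff G s f \<one>\<^bsub>G\<^esub>)"

definition Theta :: "('a, 'b) monoid_scheme \<Rightarrow> 'a set \<Rightarrow>
    ('a \<Rightarrow> complex) set \<Rightarrow> 'a set \<Rightarrow> complex" where
  "Theta G S C = (THE \<phi>. is_Theta_value G S C \<phi>)"

definition hom_pullback :: "('a, 'b) monoid_scheme \<Rightarrow> ('a set \<Rightarrow> complex) \<Rightarrow> 'a \<Rightarrow> complex" where
  "hom_pullback G \<phi> = (\<lambda>x\<in>carrier G. \<phi> (ab_class G x))"

end

theory Submission
  imports Defs
begin

text \<open>
  A Lipschitz harmonic function \<open>f\<close> is shown to be affine by descending the lower central series.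
  Suppose \<open>f\<close> is invariant under the \<open>k+1\<close>-st term and let \<open>z\<close> lie in the \<open>k\<close>-th term. Then
  \<open>u(x) = f(xz) - f(x)\<close> is bounded and harmonic. If \<open>u(x)\<close> is close to \<open>sup u\<close>, then by harmonicity and
  adaptedness so is \<open>u(xg)\<close> for any given \<open>g\<close>, in particular for \<open>g = z, z\<^sup>2, \<dots>\<close>; hence
  \<open>f(xz\<^sup>n) - f(x)\<close> comes close to \<open>n sup u\<close>. For a commutator \<open>z = [a,b]\<close> this difference taken at \<open>n\<^sup>2\<close>
  is only \<open>O(n)\<close>, since modulo the \<open>k+1\<close>-st term the \<open>n\<^sup>2\<close>-th power of \<open>z\<close> is \<open>[a\<^sup>n,b\<^sup>n]\<close>. So
  \<open>u = 0\<close>, and eventually \<open>f\<close> is invariant under \<open>[G,G]\<close>. Then, for every \<open>y\<close>, the bounded harmonic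
  function \<open>f(xy) - f(x)\<close> is constant by the same argument, as sums of its differences telescope to
  bounded quantities. Conversely, centering is exactly what makes homomorphisms harmonic.
\<close>

subsection \<open>Harmonic functions with bounded differences\<close>


lemma pmf_has_sum_1:
  assumes "set_pmf \<mu> \<subseteq> A"
  shows "(pmf \<mu> has_sum 1) A"
proof -
  have "infsum (pmf \<mu>) A = infsetsum (pmf \<mu>) A"
    by (simp add: infsetsum_infsum pmf_abs_summable)
  moreover have "pmf \<mu> summable_on A"
    using pmf_abs_summable[of \<mu> A] abs_summable_equivalent abs_summable_summable by blast
  ultimately show ?thesis
    using infsetsum_pmf_eq_1[OF assms] by (simp add: has_sum_iff)
qed

lemma archimedean_mult:
  fixes e K :: real
  assumes "e > 0"
  shows "\<exists>n::nat. n > 0 \<and> K \<le> e * real n"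
proof -
  obtain n :: nat where "K / e < real n" using reals_Archimedean2 by blast
  then have "K \<le> e * real (Suc n)" using assms by (simp add: field_simps)
  then show ?thesis by blast
qed

locale adapted_walk = group G for G (structure) +
  fixes \<mu> :: "'a pmf"
  assumes supp: "set_pmf \<mu> \<subseteq> carrier G"
    and adapted: "adapted G \<mu>"
begin

text \<open>Real values, so that suprema can be compared; complex functions are treated through
  their real and imaginary parts. For real series, \<open>has_sum\<close> already contains absolute
  convergence.\<close>

definition real_harmonic :: "('a \<Rightarrow> real) \<Rightarrow> bool" where
  "real_harmonic f \<longleftrightarrow>
     (\<forall>k\<in>carrier G. ((\<lambda>g. pmf \<mu> g * f (k \<otimes> g)) has_sum f k) (carrier G))"

text \<open>A form of the Lipschitz condition free of the generating set: the bound may depend on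
  \<open>g\<close>, but not on \<open>x\<close>.\<close>

definition bounded_differences :: "('a \<Rightarrow> real) \<Rightarrow> bool" where
  "bounded_differences f \<longleftrightarrow>
     (\<forall>g\<in>carrier G. \<exists>K. \<forall>x\<in>carrier G. \<bar>f (x \<otimes> g) - f x\<bar> \<le> K)"

text \<open>For a normal subgroup \<open>N\<close> this says that \<open>f\<close> descends to the
  quotient by \<open>N\<close>; phrased this way, no quotient group has to be formed.\<close>

definition invariant_under :: "'a set \<Rightarrow> ('a \<Rightarrow> real) \<Rightarrow> bool" where
  "invariant_under N f \<longleftrightarrow> (\<forall>x\<in>carrier G. \<forall>n\<in>N. f (x \<otimes> n) = f x)"

section \<open>A quantitative maximum principle\<close>

lemma real_harmonic_uminus: "real_harmonic f \<Longrightarrow> real_harmonic (\<lambda>x. - f x)"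
  by (simp add: real_harmonic_def has_sum_uminus)

text \<open>The gap \<open>M - u x\<close> is the \<mu>-average of the nonnegative gaps at
  \<open>x \<otimes> h\<close>. Each term is bounded by the whole average, so
  \<open>1 / pmf \<mu> g\<close> serves as \<open>C\<close> for \<open>g\<close> in the support.
  Constants multiply along products, and by adaptedness products of support elements exhaust
  \<open>G\<close>.\<close>

lemma gap_propagates:
  assumes u: "real_harmonic u" and M: "\<And>x. x \<in> carrier G \<Longrightarrow> u x \<le> M"
    and g: "g \<in> carrier G"
  shows "\<exists>C>0. \<forall>x\<in>carrier G. M - u (x \<otimes> g) \<le> C * (M - u x)"
proof -
  have "g \<in> semigroup_generated G (set_pmf \<mu>)"
    using adapted g by (simp add: adapted_def)
  then show ?thesis
  proof (induction rule: semigroup_generated.induct)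
    case (incl g)
    have p: "pmf \<mu> g > 0" and gc: "g \<in> carrier G"
      using incl supp by (auto simp: pmf_positive)
    have "M - u (x \<otimes> g) \<le> (1 / pmf \<mu> g) * (M - u x)" if x: "x \<in> carrier G" for x
    proof -
      have "((\<lambda>h. pmf \<mu> h * M + - (pmf \<mu> h * u (x \<otimes> h))) has_sum (1 * M + - u x)) (carrier G)"
        using u x pmf_has_sum_1[OF supp]
        by (intro has_sum_add has_sum_cmult_left) (auto simp: real_harmonic_def has_sum_uminus)
      then have "((\<lambda>h. pmf \<mu> h * (M - u (x \<otimes> h))) has_sum (M - u x)) (carrier G)"
        by (simp add: algebra_simps)
      from finite_sum_le_has_sum[OF this, of "{g}"]
      have "pmf \<mu> g * (M - u (x \<otimes> g)) \<le> M - u x"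
        using gc M x by simp
      then show ?thesis using p by (simp add: field_simps)
    qed
    then show ?case using p by (intro exI[of _ "1 / pmf \<mu> g"]) auto
  next
    case (mult g h)
    then obtain C D where CD: "C > 0" "D > 0"
      and C: "\<And>x. x \<in> carrier G \<Longrightarrow> M - u (x \<otimes> g) \<le> C * (M - u x)"
      and D: "\<And>x. x \<in> carrier G \<Longrightarrow> M - u (x \<otimes> h) \<le> D * (M - u x)"
      by blast
    have gh: "g \<in> carrier G" "h \<in> carrier G"
      using mult.hyps adapted by (auto simp: adapted_def)
    have "M - u (x \<otimes> (g \<otimes> h)) \<le> D * C * (M - u x)" if x: "x \<in> carrier G" for x
    proof -
      have "M - u (x \<otimes> (g \<otimes> h)) \<le> D * (M - u (x \<otimes> g))"
        using D[of "x \<otimes> g"] x gh by (simp add: m_assoc)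
      also have "\<dots> \<le> D * (C * (M - u x))"
        using C[OF x] CD by (intro mult_left_mono) auto
      finally show ?thesis by (simp add: algebra_simps)
    qed
    then show ?case using CD by (intro exI[of _ "D * C"]) auto
  qed
qed

text \<open>The supremum \<open>M\<close> need not be attained, so the argument runs at a point
  where \<open>u\<close> is nearly \<open>M\<close>. If \<open>M\<close> were positive, the next
  \<open>n\<close> values along powers of \<open>z\<close> would also be nearly \<open>M\<close>,
  and their sum would exceed \<open>n * M / 2\<close>.\<close>

lemma nonpos_of_sublinear_sums:
  assumes u: "real_harmonic u" and B: "\<And>x. x \<in> carrier G \<Longrightarrow> u x \<le> B"
    and z: "z \<in> carrier G"
    and sub: "\<And>e. e > 0 \<Longrightarrow>
      \<exists>n>0. \<forall>x\<in>carrier G. (\<Sum>j<n. u (x \<otimes> z [^] (j::nat))) \<le> e * real n"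
    and y: "y \<in> carrier G"
  shows "u y \<le> 0"
proof (rule ccontr)
  assume "\<not> u y \<le> 0"
  define M where "M = (SUP x\<in>carrier G. u x)"
  have bdd: "bdd_above (u ` carrier G)"
    using B by (auto simp: bdd_above_def)
  have le: "u x \<le> M" if "x \<in> carrier G" for x
    unfolding M_def using that bdd by (rule cSUP_upper)
  have Mpos: "M > 0" using le[OF y] \<open>\<not> u y \<le> 0\<close> by linarith
  obtain n where n: "n > 0"
    and sum_le: "\<And>x. x \<in> carrier G \<Longrightarrow> (\<Sum>j<n. u (x \<otimes> z [^] j)) \<le> M / 2 * real n"
    using sub[of "M / 2"] Mpos by auto
  have "\<forall>j. \<exists>C>0. \<forall>x\<in>carrier G. M - u (x \<otimes> z [^] (j::nat)) \<le> C * (M - u x)"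
    using gap_propagates[OF u le] z by auto
  then obtain C where C0: "\<And>j. C j > 0"
    and C: "\<And>j x. x \<in> carrier G \<Longrightarrow> M - u (x \<otimes> z [^] (j::nat)) \<le> C j * (M - u x)"
    by metis
  \<comment> \<open>At any point \<open>x\<close> the \<open>n\<close> gaps along the powers of
    \<open>z\<close> add up to at most \<open>K * (M - u x)\<close>.\<close>
  define K where "K = (\<Sum>j<n. C j)"
  have K: "K > 0" unfolding K_def using n C0 by (intro sum_pos) auto
  \<comment> \<open>The tolerance \<open>M * n / (2 * K)\<close> makes the total gap smaller than
    \<open>n * M / 2\<close>.\<close>
  have "M - M * n / (2 * K) < M" using K n Mpos by simp
  then obtain x where x: "x \<in> carrier G" and ux: "M - M * n / (2 * K) < u x"
    unfolding M_def using less_cSUP_iff[OF _ bdd] y by blast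
  have "real n * M - (\<Sum>j<n. u (x \<otimes> z [^] j)) = (\<Sum>j<n. M - u (x \<otimes> z [^] j))"
    by (simp add: sum_subtractf)
  also have "\<dots> \<le> (\<Sum>j<n. C j * (M - u x))"
    using C[OF x] by (intro sum_mono) auto
  also have "\<dots> = K * (M - u x)" by (simp add: K_def sum_distrib_right)
  also have "\<dots> < K * (M * n / (2 * K))" using K ux by (intro mult_strict_left_mono) auto
  also have "\<dots> = M / 2 * n" using K by simp
  finally show False using sum_le[OF x] by (simp add: algebra_simps)
qed

text \<open>Left translations preserve harmonicity, right translations in general do not. The
  hypothesis on \<open>z\<close> turns the right translate into one that can be averaged like a left
  translate.\<close>

lemma real_harmonic_diff:
  assumes f: "real_harmonic f" and z: "z \<in> carrier G"
    and com: "\<And>x g. x \<in> carrier G \<Longrightarrow> g \<in> carrier G \<Longrightarrow> f (x \<otimes> z \<otimes> g) = f (x \<otimes> g \<otimes> z)"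
  shows "real_harmonic (\<lambda>x. f (x \<otimes> z) - f x)"
  unfolding real_harmonic_def
proof
  fix k assume k: "k \<in> carrier G"
  have "((\<lambda>g. pmf \<mu> g * f (k \<otimes> z \<otimes> g) + - (pmf \<mu> g * f (k \<otimes> g))) has_sum
      (f (k \<otimes> z) + - f k)) (carrier G)"
    using f k z by (intro has_sum_add) (auto simp: real_harmonic_def has_sum_uminus)
  then show "((\<lambda>g. pmf \<mu> g * (f (k \<otimes> g \<otimes> z) - f (k \<otimes> g))) has_sum (f (k \<otimes> z) - f k)) (carrier G)"
    using com[OF k] unfolding diff_conv_add_uminus[symmetric]
    by (simp add: right_diff_distrib cong: has_sum_cong)
qed

text \<open>The sums of \<open>f (x \<otimes> z) - f x\<close> along powers of \<open>z\<close>
  telescope to \<open>f (x \<otimes> z [^] n) - f x\<close>, so the preceding bound applies to this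
  difference and to its negative.\<close>

lemma invariant_of_sublinear:
  assumes f: "real_harmonic f" and bd: "bounded_differences f" and z: "z \<in> carrier G"
    and com: "\<And>x g. x \<in> carrier G \<Longrightarrow> g \<in> carrier G \<Longrightarrow> f (x \<otimes> z \<otimes> g) = f (x \<otimes> g \<otimes> z)"
    and sub: "\<And>e. e > 0 \<Longrightarrow>
      \<exists>n>0. \<forall>x\<in>carrier G. \<bar>f (x \<otimes> z [^] (n::nat)) - f x\<bar> \<le> e * real n"
    and x: "x \<in> carrier G"
  shows "f (x \<otimes> z) = f x"
proof -
  let ?u = "\<lambda>x. f (x \<otimes> z) - f x"
  have u: "real_harmonic ?u" by (rule real_harmonic_diff[OF f z com])
  obtain K where K: "\<And>x. x \<in> carrier G \<Longrightarrow> \<bar>?u x\<bar> \<le> K"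
    using bd z unfolding bounded_differences_def by blast
  have tele: "(\<Sum>j<n. ?u (x \<otimes> z [^] (j::nat))) = f (x \<otimes> z [^] n) - f x"
    if "x \<in> carrier G" for x and n :: nat
    using sum_lessThan_telescope[of "\<lambda>j. f (x \<otimes> z [^] j)" n] that z by (simp add: m_assoc)
  have "?u x \<le> 0"
  proof (rule nonpos_of_sublinear_sums[OF u _ z _ x])
    show "?u x \<le> K" if "x \<in> carrier G" for x using K[OF that] by linarith
    fix e :: real assume "e > 0"
    from sub[OF this] show "\<exists>n>0. \<forall>x\<in>carrier G. (\<Sum>j<n. ?u (x \<otimes> z [^] (j::nat))) \<le> e * real n"
      by (simp add: tele abs_le_iff) blast
  qed
  moreover have "- ?u x \<le> 0"
  proof (rule nonpos_of_sublinear_sums[OF real_harmonic_uminus[OF u] _ z _ x])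
    show "- ?u x \<le> K" if "x \<in> carrier G" for x using K[OF that] by linarith
    fix e :: real assume "e > 0"
    from sub[OF this] show "\<exists>n>0. \<forall>x\<in>carrier G. (\<Sum>j<n. - ?u (x \<otimes> z [^] (j::nat))) \<le> e * real n"
      by (simp only: sum_negf tele abs_le_iff) (simp add: tele abs_le_iff, blast)
  qed
  ultimately show ?thesis by linarith
qed

section \<open>Powers of commutators\<close>

lemma bounded_differences_pow:
  assumes "bounded_differences f" "g \<in> carrier G"
  shows "\<exists>K\<ge>0. \<forall>x\<in>carrier G. \<forall>n::nat. \<bar>f (x \<otimes> g [^] n) - f x\<bar> \<le> K * real n"
proof -
  obtain K where K: "\<And>x. x \<in> carrier G \<Longrightarrow> \<bar>f (x \<otimes> g) - f x\<bar> \<le> K"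
    using assms unfolding bounded_differences_def by blast
  have "\<bar>f (x \<otimes> g [^] n) - f x\<bar> \<le> K * real n" if x: "x \<in> carrier G" for x and n :: nat
  proof (induction n)
    case (Suc n)
    have "\<bar>f (x \<otimes> g [^] Suc n) - f (x \<otimes> g [^] n)\<bar> \<le> K"
      using K[of "x \<otimes> g [^] n"] x assms(2) by (simp add: m_assoc)
    then show ?case using Suc by (simp add: algebra_simps)
  qed (use x in simp)
  moreover have "K \<ge> 0" using K[OF one_closed] by linarith
  ultimately show ?thesis by blast
qed

text \<open>Moving one \<open>a\<close> past one \<open>b\<close> costs one factor \<open>z\<close>,
  which slides to the right end under \<open>f\<close>; moving \<open>m\<close> letters past
  \<open>n\<close> letters costs \<open>m * n\<close> factors. The free tail \<open>y\<close>
  collects letters and factors already moved during the inductions.\<close>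

lemma move_commutator_powers:
  assumes a: "a \<in> carrier G" and b: "b \<in> carrier G" and z: "z = a \<otimes> b \<otimes> inv a \<otimes> inv b"
    and com: "\<And>x g. x \<in> carrier G \<Longrightarrow> g \<in> carrier G \<Longrightarrow> f (x \<otimes> z \<otimes> g) = f (x \<otimes> g \<otimes> z)"
    and x: "x \<in> carrier G" and y: "y \<in> carrier G"
  shows "f (x \<otimes> a [^] (m::nat) \<otimes> b [^] (n::nat) \<otimes> y) =
    f (x \<otimes> b [^] n \<otimes> a [^] m \<otimes> y \<otimes> z [^] (m * n))"
proof -
  have zc: "z \<in> carrier G" using a b z by simp
  have ab: "a \<otimes> b = z \<otimes> b \<otimes> a" unfolding z using a b by (simp add: m_assoc)
  have swap1: "f (x \<otimes> a \<otimes> b \<otimes> y) = f (x \<otimes> b \<otimes> a \<otimes> y \<otimes> z)"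
    if "x \<in> carrier G" "y \<in> carrier G" for x y
  proof -
    have "x \<otimes> a \<otimes> b \<otimes> y = x \<otimes> (a \<otimes> b) \<otimes> y" using that a b by (simp add: m_assoc)
    also have "\<dots> = x \<otimes> z \<otimes> (b \<otimes> a \<otimes> y)" unfolding ab using that a b zc by (simp add: m_assoc)
    finally show ?thesis using com[of x "b \<otimes> a \<otimes> y"] that a b zc by (simp add: m_assoc)
  qed
  \<comment> \<open>A single \<open>a\<close> passes the \<open>b\<close>s one at a time: each
    \<open>b\<close> passed joins \<open>x\<close>, and each new \<open>z\<close> joins
    \<open>y\<close>.\<close>
  have swap2: "f (x \<otimes> a \<otimes> b [^] n \<otimes> y) = f (x \<otimes> b [^] n \<otimes> a \<otimes> y \<otimes> z [^] n)"
    if "x \<in> carrier G" "y \<in> carrier G" for x y and n :: nat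
    using that
  proof (induction n arbitrary: x y)
    case 0
    then show ?case using a by simp
  next
    case (Suc n)
    have bS: "b [^] Suc n = b \<otimes> b [^] n" by (rule nat_pow_Suc2[OF b])
    have zS: "z [^] Suc n = z \<otimes> z [^] n" by (rule nat_pow_Suc2[OF zc])
    have "f (x \<otimes> a \<otimes> b [^] Suc n \<otimes> y) = f (x \<otimes> a \<otimes> b \<otimes> (b [^] n \<otimes> y))"
      unfolding bS using Suc.prems a b by (simp add: m_assoc)
    also have "\<dots> = f (x \<otimes> b \<otimes> a \<otimes> b [^] n \<otimes> (y \<otimes> z))"
      using swap1[of x "b [^] n \<otimes> y"] Suc.prems a b zc by (simp add: m_assoc)
    also have "\<dots> = f (x \<otimes> b \<otimes> b [^] n \<otimes> a \<otimes> (y \<otimes> z) \<otimes> z [^] n)"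
      using Suc.IH[of "x \<otimes> b" "y \<otimes> z"] Suc.prems b zc by simp
    also have "\<dots> = f (x \<otimes> b [^] Suc n \<otimes> a \<otimes> y \<otimes> z [^] Suc n)"
      unfolding bS zS using Suc.prems a b zc by (simp add: m_assoc)
    finally show ?case .
  qed
  show ?thesis using y
  proof (induction m arbitrary: y)
    case 0
    then show ?case using x b by simp
  next
    case (Suc m)
    \<comment> \<open>The rightmost \<open>a\<close> moves first, so the remaining \<open>m\<close>
      of them meet the unchanged block of \<open>b\<close>s.\<close>
    have "f (x \<otimes> a [^] Suc m \<otimes> b [^] n \<otimes> y) = f (x \<otimes> a [^] m \<otimes> a \<otimes> b [^] n \<otimes> y)"
      using Suc.prems x a b by (simp add: m_assoc)
    also have "\<dots> = f (x \<otimes> a [^] m \<otimes> b [^] n \<otimes> (a \<otimes> y \<otimes> z [^] n))"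
      using swap2[of "x \<otimes> a [^] m" y n] Suc.prems x a b zc by (simp add: m_assoc)
    also have "\<dots> = f (x \<otimes> b [^] n \<otimes> a [^] m \<otimes> (a \<otimes> y \<otimes> z [^] n) \<otimes> z [^] (m * n))"
      using Suc.IH[of "a \<otimes> y \<otimes> z [^] n"] Suc.prems a zc by simp
    also have "\<dots> = f (x \<otimes> b [^] n \<otimes> a [^] Suc m \<otimes> y \<otimes> z [^] (Suc m * n))"
      using Suc.prems x a b zc by (simp add: m_assoc nat_pow_mult)
    finally show ?case .
  qed
qed

text \<open>
  Modulo a subgroup under which \<open>f\<close> is invariant, \<open>z\<close> is central and \<open>z\<close> to the power \<open>n\<^sup>2\<close> is the
  commutator of \<open>a\<close> and \<open>b\<close> to the power \<open>n\<close>, a word of length \<open>4 * n\<close> in \<open>a\<close>, \<open>b\<close> and their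
  inverses.
\<close>

lemma invariant_commutator:
  assumes f: "real_harmonic f" and bd: "bounded_differences f"
    and a: "a \<in> carrier G" and b: "b \<in> carrier G" and z: "z = a \<otimes> b \<otimes> inv a \<otimes> inv b"
    and com: "\<And>x g. x \<in> carrier G \<Longrightarrow> g \<in> carrier G \<Longrightarrow> f (x \<otimes> z \<otimes> g) = f (x \<otimes> g \<otimes> z)"
    and x: "x \<in> carrier G"
  shows "f (x \<otimes> z) = f x"
proof -
  have zc: "z \<in> carrier G" using a b z by simp
  have ia: "inv a \<in> carrier G" and ib: "inv b \<in> carrier G" using a b by auto
  obtain K1 where K1: "K1 \<ge> 0" "\<And>x n. x \<in> carrier G \<Longrightarrow> \<bar>f (x \<otimes> a [^] (n::nat)) - f x\<bar> \<le> K1 * real n"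
    using bounded_differences_pow[OF bd a] by blast
  obtain K2 where K2: "K2 \<ge> 0" "\<And>x n. x \<in> carrier G \<Longrightarrow> \<bar>f (x \<otimes> b [^] (n::nat)) - f x\<bar> \<le> K2 * real n"
    using bounded_differences_pow[OF bd b] by blast
  obtain K3 where K3: "K3 \<ge> 0" "\<And>x n. x \<in> carrier G \<Longrightarrow> \<bar>f (x \<otimes> inv a [^] (n::nat)) - f x\<bar> \<le> K3 * real n"
    using bounded_differences_pow[OF bd ia] by blast
  obtain K4 where K4: "K4 \<ge> 0" "\<And>x n. x \<in> carrier G \<Longrightarrow> \<bar>f (x \<otimes> inv b [^] (n::nat)) - f x\<bar> \<le> K4 * real n"
    using bounded_differences_pow[OF bd ib] by blast
  define K where "K = K1 + K2 + K3 + K4"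
  have K: "K \<ge> 0" using K1 K2 K3 K4 by (simp add: K_def)
  have lin: "\<bar>f (x \<otimes> z [^] (n * n)) - f x\<bar> \<le> K * n" if x: "x \<in> carrier G" for x and n :: nat
  proof -
    have cancel: "a [^] n \<otimes> inv a [^] n = \<one>" "b [^] n \<otimes> inv b [^] n = \<one>"
      using a b by (simp_all add: nat_pow_inv)
    \<comment> \<open>After the swap, the word in \<open>a\<close>, \<open>b\<close> and their
      inverses cancels, and only the power of \<open>z\<close> is left.\<close>
    have "f (x \<otimes> a [^] n \<otimes> b [^] n \<otimes> (inv a [^] n \<otimes> inv b [^] n))
        = f (x \<otimes> b [^] n \<otimes> a [^] n \<otimes> (inv a [^] n \<otimes> inv b [^] n) \<otimes> z [^] (n * n))"
      using move_commutator_powers[where f=f, OF a b z com x] a b by simp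
    also have "x \<otimes> b [^] n \<otimes> a [^] n \<otimes> (inv a [^] n \<otimes> inv b [^] n)
        = x \<otimes> (b [^] n \<otimes> (a [^] n \<otimes> inv a [^] n) \<otimes> inv b [^] n)"
      using x a b by (simp add: m_assoc)
    also have "\<dots> = x" using x a b by (simp add: cancel)
    finally have eq: "f (x \<otimes> z [^] (n * n)) = f (x \<otimes> a [^] n \<otimes> b [^] n \<otimes> inv a [^] n \<otimes> inv b [^] n)"
      using x a b by (simp add: m_assoc)
    have "\<bar>f (x \<otimes> a [^] n) - f x\<bar> \<le> K1 * real n"
      "\<bar>f (x \<otimes> a [^] n \<otimes> b [^] n) - f (x \<otimes> a [^] n)\<bar> \<le> K2 * real n"
      "\<bar>f (x \<otimes> a [^] n \<otimes> b [^] n \<otimes> inv a [^] n) - f (x \<otimes> a [^] n \<otimes> b [^] n)\<bar> \<le> K3 * real n"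
      "\<bar>f (x \<otimes> a [^] n \<otimes> b [^] n \<otimes> inv a [^] n \<otimes> inv b [^] n)
        - f (x \<otimes> a [^] n \<otimes> b [^] n \<otimes> inv a [^] n)\<bar> \<le> K4 * real n"
      using x a b by (intro K1 K2 K3 K4; simp)+
    then show ?thesis unfolding eq K_def by (simp add: algebra_simps)
  qed
  show ?thesis
  proof (rule invariant_of_sublinear[OF f bd zc com _ x])
    fix e :: real assume e: "e > 0"
    \<comment> \<open>The sublinear bound is needed at one exponent only; it is taken at
      \<open>n * n\<close>, where the growth \<open>K * n\<close> is at most
      \<open>e * n * n\<close>.\<close>
    obtain n :: nat where n0: "n > 0" and Kn: "K \<le> e * real n"
      using archimedean_mult[OF e] by blast
    have "K * real n \<le> e * real (n * n)"
      using mult_right_mono[OF Kn, of "real n"] by (simp add: algebra_simps)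
    then have "\<forall>x\<in>carrier G. \<bar>f (x \<otimes> z [^] (n * n)) - f x\<bar> \<le> e * real (n * n)"
      using order_trans[OF lin] by blast
    then show "\<exists>n>0. \<forall>x\<in>carrier G. \<bar>f (x \<otimes> z [^] (n::nat)) - f x\<bar> \<le> e * real n"
      using n0 by (intro exI[of _ "n * n"]) simp
  qed
qed

section \<open>Descent along the lower central series\<close>

lemma lower_central_subgroup: "subgroup (lower_central G n) G"
proof (induction n)
  case (Suc n)
  then show ?case
    by (auto intro!: generate_is_subgroup dest: subgroup.mem_carrier)
qed (simp add: subgroup_self)

text \<open>Exchanging \<open>z\<close> and \<open>g\<close> costs a commutator in the next term of
  the series, which \<open>f\<close> does not see.\<close>

lemma lower_central_commute:
  assumes inv: "invariant_under (lower_central G (Suc k)) f"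
    and z: "z \<in> lower_central G k" and x: "x \<in> carrier G" and g: "g \<in> carrier G"
  shows "f (x \<otimes> z \<otimes> g) = f (x \<otimes> g \<otimes> z)"
proof -
  interpret H: subgroup "lower_central G k" G by (rule lower_central_subgroup)
  have zc: "z \<in> carrier G" using z by (rule H.mem_carrier)
  \<comment> \<open>The double inverses keep \<open>?w\<close> in the literal shape of a generator
    of the next term.\<close>
  let ?w = "inv z \<otimes> inv g \<otimes> inv (inv z) \<otimes> inv (inv g)"
  have w: "?w \<in> lower_central G (Suc k)"
    unfolding lower_central.simps using z g by (intro generate.incl) blast
  have "z \<otimes> (inv z \<otimes> t) = t" "g \<otimes> (inv g \<otimes> t) = t" if "t \<in> carrier G" for t
    using that g zc by (simp_all add: m_assoc[symmetric])
  then have "x \<otimes> z \<otimes> g = x \<otimes> g \<otimes> z \<otimes> ?w"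
    using x g zc by (simp add: m_assoc)
  then show ?thesis using inv w x g zc by (simp add: invariant_under_def)
qed

lemma invariant_under_generate:
  assumes A: "A \<subseteq> carrier G" and inv: "invariant_under A f"
  shows "invariant_under (generate G A) f"
proof -
  have "f (x \<otimes> n) = f x" if "n \<in> generate G A" "x \<in> carrier G" for x n
    using that
  proof (induction arbitrary: x rule: generate.induct)
    case (inv h)
    then have "f (x \<otimes> inv h \<otimes> h) = f (x \<otimes> inv h)"
      using A assms(2) by (auto simp: invariant_under_def)
    then show ?case using inv A by (auto simp: m_assoc subset_iff)
  next
    case (eng h1 h2)
    then have "h1 \<in> carrier G" "h2 \<in> carrier G" using A generate_in_carrier by auto
    then show ?case using eng.IH(1)[of x] eng.IH(2)[of "x \<otimes> h1"] eng.prems by (simp add: m_assoc)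
  qed (use assms(2) in \<open>auto simp: invariant_under_def\<close>)
  then show ?thesis by (simp add: invariant_under_def)
qed

text \<open>It is enough to treat the generating commutators. They lie in
  \<open>lower_central G (Suc k)\<close>, so by the invariance already known they are central as far
  as \<open>f\<close> is concerned.\<close>

lemma invariant_lower_central_step:
  assumes f: "real_harmonic f" and bd: "bounded_differences f"
    and inv: "invariant_under (lower_central G (Suc (Suc k))) f"
  shows "invariant_under (lower_central G (Suc k)) f"
  unfolding lower_central.simps(2)[of G k]
proof (rule invariant_under_generate)
  let ?C = "{x \<otimes> y \<otimes> inv x \<otimes> inv y |x y. x \<in> lower_central G k \<and> y \<in> carrier G}"
  have sub: "lower_central G k \<subseteq> carrier G" by (rule subgroup.subset[OF lower_central_subgroup])
  then show "?C \<subseteq> carrier G" by auto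
  show "invariant_under ?C f"
    unfolding invariant_under_def
  proof (intro ballI)
    fix x z assume x: "x \<in> carrier G" and z: "z \<in> ?C"
    then obtain a b where ab: "a \<in> lower_central G k" "b \<in> carrier G" "z = a \<otimes> b \<otimes> inv a \<otimes> inv b"
      by blast
    have "z \<in> lower_central G (Suc k)"
      using z by (auto intro: generate.incl)
    then show "f (x \<otimes> z) = f x"
      using ab sub x by (intro invariant_commutator[OF f bd _ ab(2,3) lower_central_commute[OF inv]]) auto
  qed
qed

text \<open>Once \<open>f\<close> is invariant under commutators,
  \<open>f (x \<otimes> y) - f x\<close> is itself harmonic in \<open>x\<close>. It is bounded by
  some \<open>K\<close>, so its own differences never exceed \<open>2 * K\<close>, which is
  trivially sublinear; hence it is constant in \<open>x\<close>.\<close>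

theorem real_harmonic_affine:
  assumes f: "real_harmonic f" and bd: "bounded_differences f"
    and nil: "lower_central G n = {\<one>}"
    and x: "x \<in> carrier G" and y: "y \<in> carrier G"
  shows "f (x \<otimes> y) - f x = f y - f \<one>"
proof -
  \<comment> \<open>One further term is also trivial; starting from a successor index lets the
    descent cover \<open>n = 0\<close>.\<close>
  have "lower_central G (Suc n) = {\<one>}"
  proof -
    have "{x \<otimes> y \<otimes> inv x \<otimes> inv y |x y. x \<in> {\<one>} \<and> y \<in> carrier G} = {\<one>}"
      by (auto intro!: exI[of _ \<one>])
    then show ?thesis by (simp only: lower_central.simps nil generate_one)
  qed
  then have "invariant_under (lower_central G (Suc n)) f"
    by (simp add: invariant_under_def)
  then have "invariant_under (lower_central G (Suc 0)) f"
    by (induction n) (auto dest: invariant_lower_central_step[OF f bd] simp del: lower_central.simps)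
  then have com: "f (x \<otimes> z \<otimes> g) = f (x \<otimes> g \<otimes> z)"
    if "x \<in> carrier G" "z \<in> carrier G" "g \<in> carrier G" for x z g
    using lower_central_commute[of 0] that by simp
  let ?u = "\<lambda>x. f (x \<otimes> y) - f x"
  have u: "real_harmonic ?u" using real_harmonic_diff[OF f y] com y by blast
  obtain K where K: "\<And>x. x \<in> carrier G \<Longrightarrow> \<bar>?u x\<bar> \<le> K"
    using bd y unfolding bounded_differences_def by blast
  have uK: "\<bar>?u (x \<otimes> g) - ?u x\<bar> \<le> 2 * K" if "x \<in> carrier G" "g \<in> carrier G" for x g
    using K[of "x \<otimes> g"] K[of x] that by simp
  \<comment> \<open>The invariance criterion, applied to \<open>?u\<close> with \<open>x\<close> as
    the translating element, is evaluated at the identity.\<close>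
  have "?u (\<one> \<otimes> x) = ?u \<one>"
  proof (rule invariant_of_sublinear[OF u _ x])
    show "bounded_differences ?u" unfolding bounded_differences_def using uK by blast
    show "?u (w \<otimes> x \<otimes> g) = ?u (w \<otimes> g \<otimes> x)" if "w \<in> carrier G" "g \<in> carrier G" for w g
    proof -
      have "f (w \<otimes> x \<otimes> g \<otimes> y) = f (w \<otimes> g \<otimes> y \<otimes> x)"
        using com[of w x "g \<otimes> y"] that x y by (simp add: m_assoc)
      then show ?thesis using com[of "w \<otimes> g" x y] com[of w x g] that x y by simp
    qed
    fix e :: real assume e: "e > 0"
    obtain n :: nat where "n > 0" and Kn: "2 * K \<le> e * real n"
      using archimedean_mult[OF e] by blast
    moreover have "\<forall>w\<in>carrier G. \<bar>?u (w \<otimes> x [^] n) - ?u w\<bar> \<le> e * real n"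
      using order_trans[OF uK[OF _ nat_pow_closed[OF x, of n]] Kn] by blast
    ultimately show "\<exists>n>0. \<forall>w\<in>carrier G. \<bar>?u (w \<otimes> x [^] (n::nat)) - ?u w\<bar> \<le> e * real n"
      by blast
  qed simp
  then show ?thesis using x y by simp
qed

end

subsection \<open>Homomorphisms to the reals and the complex numbers\<close>


lemma plus_group_simps [simp]:
  "carrier plus_group = UNIV" "x \<otimes>\<^bsub>plus_group\<^esub> y = x + y" "\<one>\<^bsub>plus_group\<^esub> = 0"
  by (simp_all add: plus_group_def)

lemma comm_group_plus_group: "comm_group plus_group"
proof (rule comm_groupI)
  fix x :: 'a
  have "- x + x = 0" by simp
  then show "\<exists>y\<in>carrier plus_group. y \<otimes>\<^bsub>plus_group\<^esub> x = \<one>\<^bsub>plus_group\<^esub>"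
    unfolding plus_group_simps by blast
qed (simp_all add: algebra_simps)

lemma group_plus_group: "group plus_group"
  by (rule comm_group.axioms(2)[OF comm_group_plus_group])

text \<open>The kernel is a subgroup, so triviality on generators suffices. This fits both the
  tensor relations and the derived subgroup, which are given by generators.\<close>

lemma hom_factors_through_Mod:
  assumes "group G" "group H" and h: "h \<in> hom G H" and N: "generate G R \<lhd> G"
    and R: "R \<subseteq> carrier G" and triv: "\<And>r. r \<in> R \<Longrightarrow> h r = \<one>\<^bsub>H\<^esub>"
  obtains k where "k \<in> hom (G Mod generate G R) H"
    "\<And>x. x \<in> carrier G \<Longrightarrow> k (generate G R #>\<^bsub>G\<^esub> x) = h x"
proof -
  interpret group_hom G H h
    using assms by (simp add: group_hom_def group_hom_axioms_def)
  interpret N: normal "generate G R" G by (rule N)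
  have ker: "generate G R \<subseteq> kernel G H h"
    using R triv by (intro G.generate_subgroup_incl subgroup_kernel) (auto simp: kernel_def)
  have "h x = h y"
    if xy: "x \<in> carrier G" "y \<in> carrier G" "generate G R #>\<^bsub>G\<^esub> x = generate G R #>\<^bsub>G\<^esub> y" for x y
  proof -
    have "x \<in> generate G R #>\<^bsub>G\<^esub> y"
      using G.rcos_self[OF xy(1) N.subgroup_axioms] xy(3) by simp
    then obtain n where n: "n \<in> generate G R" "x = n \<otimes>\<^bsub>G\<^esub> y"
      by (auto simp: r_coset_def)
    then have "n \<in> carrier G" "h n = \<one>\<^bsub>H\<^esub>" using ker by (auto simp: kernel_def)
    then show ?thesis using n xy by simp
  qed
  then show thesis using FactGroup_universal[OF h N] that by blast
qed

section \<open>Linear functionals on the real tensor product\<close>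

lemma free_Abelian_group_diff_closed:
  assumes "x \<in> carrier (free_Abelian_group T)" "y \<in> carrier (free_Abelian_group T)"
  shows "x - y \<in> carrier (free_Abelian_group T)"
  using assms keys_diff[of x y] unfolding carrier_free_Abelian_group_iff by blast

text \<open>The expression \<open>r * \<psi> a\<close> is additive in each variable, so its
  extension to the free abelian group kills the biadditivity relations. These functionals turn
  convergence in the tensor product into convergence of real series.\<close>

lemma real_tensor_functional:
  assumes "group A" and \<psi>: "\<psi> \<in> hom A plus_group"
  obtains \<Phi> where "\<Phi> \<in> real_tensor_dual A"
    "\<And>a r. a \<in> carrier A \<Longrightarrow> \<Phi> (pure_tensor A a r) = r * \<psi> a"
proof -
  interpret A: group A by fact
  let ?F = "free_Abelian_group (carrier A \<times> (UNIV :: real set))"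
  let ?R = "{frag_of (a \<otimes>\<^bsub>A\<^esub> b, r) - frag_of (a, r) - frag_of (b, r) | a b r.
         a \<in> carrier A \<and> b \<in> carrier A} \<union>
      {frag_of (a, r + s) - frag_of (a, r) - frag_of (a, s) | a r s. a \<in> carrier A}"
  interpret P: comm_group "plus_group :: real monoid" by (rule comm_group_plus_group)
  interpret F: comm_group ?F by (rule abelian_free_Abelian_group)
  obtain h where h: "h \<in> hom ?F plus_group"
    and hf: "\<And>p. p \<in> carrier A \<times> UNIV \<Longrightarrow> h (frag_of p) = snd p * \<psi> (fst p)"
    using P.free_Abelian_group_universal[of "\<lambda>p. snd p * \<psi> (fst p)" "carrier A \<times> UNIV"] by auto
  have in_F: "frag_of (a, r) \<in> carrier ?F" if "a \<in> carrier A" for a r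
    using that by simp
  \<comment> \<open>The homomorphism property speaks of the group operation only, so the value at a
    difference is found by adding the subtracted terms back.\<close>
  have diff: "x - y - z \<in> carrier ?F \<and> h (x - y - z) = h x - h y - h z"
    if xyz: "x \<in> carrier ?F" "y \<in> carrier ?F" "z \<in> carrier ?F" for x y z
  proof
    show d: "x - y - z \<in> carrier ?F"
      by (intro free_Abelian_group_diff_closed xyz)
    have "h ((x - y - z) \<otimes>\<^bsub>?F\<^esub> y \<otimes>\<^bsub>?F\<^esub> z) = h (x - y - z) + h y + h z"
      using hom_mult[OF h] d xyz F.m_closed by (metis plus_group_simps(2))
    then show "h (x - y - z) = h x - h y - h z" by simp
  qed
  have R: "x \<in> carrier ?F \<and> h x = 0" if x: "x \<in> ?R" for x
    using x
  proof
    assume "x \<in> {frag_of (a \<otimes>\<^bsub>A\<^esub> b, r) - frag_of (a, r) - frag_of (b, r) | a b r.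
         a \<in> carrier A \<and> b \<in> carrier A}"
    then obtain a b r where ab: "a \<in> carrier A" "b \<in> carrier A"
      and x: "x = frag_of (a \<otimes>\<^bsub>A\<^esub> b, r) - frag_of (a, r) - frag_of (b, r)" by blast
    show ?thesis
      using diff[OF in_F in_F in_F, of "a \<otimes>\<^bsub>A\<^esub> b" a b r r r] ab hom_mult[OF \<psi> ab]
      unfolding x by (simp add: hf algebra_simps)
  next
    assume "x \<in> {frag_of (a, r + s) - frag_of (a, r) - frag_of (a, s) | a r s. a \<in> carrier A}"
    then obtain a r s where a: "a \<in> carrier A"
      and x: "x = frag_of (a, r + s) - frag_of (a, r) - frag_of (a, s)" by blast
    show ?thesis
      using diff[OF in_F in_F in_F, of a a a "r + s" r s] a
      unfolding x by (simp add: hf algebra_simps)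
  qed
  then have R1: "?R \<subseteq> carrier ?F" and R2: "\<And>x. x \<in> ?R \<Longrightarrow> h x = \<one>\<^bsub>plus_group\<^esub>"
    unfolding plus_group_simps by blast+
  have T: "generate ?F ?R \<lhd> ?F"
    by (intro F.subgroup_imp_normal F.generate_is_subgroup R1)
  obtain \<Phi> where \<Phi>: "\<Phi> \<in> hom (?F Mod generate ?F ?R) plus_group"
    and \<Phi>h: "\<And>x. x \<in> carrier ?F \<Longrightarrow> \<Phi> (generate ?F ?R #>\<^bsub>?F\<^esub> x) = h x"
    using hom_factors_through_Mod[OF F.is_group P.is_group h T R1 R2] by blast
  have pure: "\<Phi> (pure_tensor A a r) = r * \<psi> a" if "a \<in> carrier A" for a r
    using \<Phi>h[OF in_F[OF that, of r]] hf[of "(a, r)"] that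
    by (simp add: pure_tensor_def tensor_relations_def)
  moreover have "\<Phi> \<in> real_tensor_dual A"
    using \<Phi> pure by (auto simp: real_tensor_dual_def real_tensor_def tensor_relations_def)
  ultimately show thesis using that by blast
qed

lemma comm_group_real_tensor:
  assumes "group A"
  shows "comm_group (real_tensor A)"
proof -
  interpret A: group A by fact
  let ?F = "free_Abelian_group (carrier A \<times> (UNIV :: real set))"
  interpret F: comm_group ?F by (rule abelian_free_Abelian_group)
  have "subgroup (tensor_relations A) ?F"
    unfolding tensor_relations_def
    by (rule F.generate_is_subgroup)
      (auto simp del: carrier_free_Abelian_group_iff intro!: free_Abelian_group_diff_closed)
  then show ?thesis unfolding real_tensor_def by (rule F.abelian_FactGroup)
qed

lemma pure_tensor_in_carrier: "a \<in> carrier A \<Longrightarrow> pure_tensor A a r \<in> carrier (real_tensor A)"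
  by (auto simp: pure_tensor_def real_tensor_def carrier_FactGroup)

lemma hom_plus_group_finprod:
  assumes "comm_group H" "\<Phi> \<in> hom H plus_group" "finite I" "p \<in> I \<rightarrow> carrier H"
  shows "\<Phi> (finprod H p I) = (\<Sum>i\<in>I. \<Phi> (p i))"
proof -
  interpret H: comm_group H by fact
  have one: "\<Phi> \<one>\<^bsub>H\<^esub> = 0"
    using hom_one[OF assms(2) H.is_group group_plus_group] by simp
  show ?thesis using assms(3,4)
  proof (induction I)
    case (insert i I)
    then show ?case using hom_mult[OF assms(2), of "p i" "finprod H p I"]
      by (simp add: H.finprod_closed Pi_iff)
  qed (simp add: one)
qed

context group
begin

section \<open>Homomorphisms of the abelianization and centering\<close>

lemma abelianization_group: "group (abelianization G)"
  unfolding abelianization_def by (rule derived_quot_is_group)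

lemma carrier_abelianization: "carrier (abelianization G) = ab_class G ` carrier G"
  by (auto simp: abelianization_def carrier_FactGroup ab_class_def)

lemma ab_class_in_carrier: "x \<in> carrier G \<Longrightarrow> ab_class G x \<in> carrier (abelianization G)"
  by (simp add: carrier_abelianization)

lemma ab_class_mult:
  assumes "x \<in> carrier G" "y \<in> carrier G"
  shows "ab_class G (x \<otimes> y) = ab_class G x \<otimes>\<^bsub>abelianization G\<^esub> ab_class G y"
  using hom_mult[OF normal.r_coset_hom_Mod[OF derived_self_is_normal] assms]
  by (simp add: ab_class_def abelianization_def)

lemma ab_hom_mult:
  assumes "\<phi> \<in> hom (abelianization G) plus_group" "x \<in> carrier G" "y \<in> carrier G"
  shows "\<phi> (ab_class G (x \<otimes> y)) = \<phi> (ab_class G x) + \<phi> (ab_class G y)"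
  using hom_mult[OF assms(1) ab_class_in_carrier ab_class_in_carrier] assms
  by (simp add: ab_class_mult)

lemma ab_hom_one:
  assumes "\<phi> \<in> hom (abelianization G) plus_group"
  shows "\<phi> (ab_class G \<one>) = 0"
  using ab_hom_mult[OF assms one_closed one_closed] by simp

lemma ab_hom_inv:
  assumes "\<phi> \<in> hom (abelianization G) plus_group" "x \<in> carrier G"
  shows "\<phi> (ab_class G (inv x)) = - \<phi> (ab_class G x)"
  using ab_hom_mult[OF assms(1), of "inv x" x] ab_hom_one[OF assms(1)] assms(2)
  by (simp add: eq_neg_iff_add_eq_0)

text \<open>The functional induced by \<open>\<psi>\<close> is continuous for the topology in which
  the centering series converges, and it maps the partial products to the partial sums of the real
  series.\<close>

lemma abelian_centered_has_sum:
  assumes cent: "abelian_centered G \<mu>" and \<psi>: "\<psi> \<in> hom (abelianization G) plus_group"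
  shows "((\<lambda>g. pmf \<mu> g * \<psi> (ab_class G g)) has_sum (0::real)) (carrier G)"
proof -
  let ?A = "abelianization G" and ?p = "\<lambda>g. pure_tensor (abelianization G) (ab_class G g) (pmf \<mu> g)"
  obtain \<Phi> where \<Phi>: "\<Phi> \<in> real_tensor_dual ?A"
    and pure: "\<And>a r. a \<in> carrier ?A \<Longrightarrow> \<Phi> (pure_tensor ?A a r) = r * \<psi> a"
    using real_tensor_functional[OF abelianization_group \<psi>] by blast
  then have hom: "\<Phi> \<in> hom (real_tensor ?A) plus_group" by (simp add: real_tensor_dual_def)
  interpret T: comm_group "real_tensor ?A"
    by (rule comm_group_real_tensor[OF abelianization_group])
  have fin: "\<Phi> (finprod (real_tensor ?A) ?p I) = (\<Sum>g\<in>I. pmf \<mu> g * \<psi> (ab_class G g))"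
    if "finite I" "I \<subseteq> carrier G" for I
    using that
    by (subst hom_plus_group_finprod[OF T.comm_group_axioms hom])
      (auto simp: pure ab_class_in_carrier intro!: pure_tensor_in_carrier sum.cong)
  have one: "\<Phi> \<one>\<^bsub>real_tensor ?A\<^esub> = 0"
    using hom_plus_group_finprod[OF T.comm_group_axioms hom, of "{}"] by simp
  have lim: "limitin (real_tensor_topology ?A) (finprod (real_tensor ?A) ?p) \<one>\<^bsub>real_tensor ?A\<^esub>
      (finite_subsets_at_top (carrier G))"
    using cent by (simp add: abelian_centered_def Let_def)
  show ?thesis
    unfolding has_sum_def
  proof (rule topological_tendstoI)
    fix U :: "real set" assume U: "open U" "0 \<in> U"
    let ?V = "{t \<in> carrier (real_tensor ?A). \<Phi> t \<in> U}"
    have "openin (real_tensor_topology ?A) ?V"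
      unfolding real_tensor_topology_def
      by (rule topology_generated_by_Basis) (use \<Phi> U in blast)
    moreover have "\<one>\<^bsub>real_tensor ?A\<^esub> \<in> ?V" using one U by simp
    ultimately have "eventually (\<lambda>I. finprod (real_tensor ?A) ?p I \<in> ?V)
        (finite_subsets_at_top (carrier G))"
      using lim unfolding limitin_def by blast
    \<comment> \<open>The formula \<open>fin\<close> holds for finite subsets of the carrier, and
      the filter eventually consists of these.\<close>
    moreover have "eventually (\<lambda>I. finite I \<and> I \<subseteq> carrier G) (finite_subsets_at_top (carrier G))"
      by (rule eventually_finite_subsets_at_top_weakI) simp
    ultimately show "eventually (\<lambda>I. (\<Sum>g\<in>I. pmf \<mu> g * \<psi> (ab_class G g)) \<in> U)
        (finite_subsets_at_top (carrier G))"
      by eventually_elim (use fin in auto)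
  qed
qed

lemma abelian_centered_has_sum_complex:
  assumes cent: "abelian_centered G \<mu>" and \<phi>: "\<phi> \<in> hom (abelianization G) plus_group"
  shows "((\<lambda>g. of_real (pmf \<mu> g) * \<phi> (ab_class G g)) has_sum (0::complex)) (carrier G)"
proof -
  have "(\<lambda>a. Re (\<phi> a)) \<in> hom (abelianization G) plus_group"
    "(\<lambda>a. Im (\<phi> a)) \<in> hom (abelianization G) plus_group"
    using \<phi> by (auto simp: hom_def)
  from this[THEN abelian_centered_has_sum[OF cent], THEN has_sum_of_real]
  have "((\<lambda>g. of_real (pmf \<mu> g * Re (\<phi> (ab_class G g))) +
      \<i> * of_real (pmf \<mu> g * Im (\<phi> (ab_class G g)))) has_sum
      (of_real 0 + \<i> * of_real 0)) (carrier G)"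
    by (intro has_sum_add has_sum_cmult_right)
  moreover have "of_real (pmf \<mu> g * Re z) + \<i> * of_real (pmf \<mu> g * Im z) = of_real (pmf \<mu> g) * z"
    for g z by (simp add: complex_eq_iff)
  ultimately show ?thesis by simp
qed

text \<open>An additive map into an abelian group kills commutators.\<close>

lemma hom_factors_through_abelianization:
  assumes add: "\<And>x y. x \<in> carrier G \<Longrightarrow> y \<in> carrier G \<Longrightarrow> F (x \<otimes> y) = F x + F y"
  obtains \<phi> where "\<phi> \<in> ab_Hom G" "\<And>x. x \<in> carrier G \<Longrightarrow> \<phi> (ab_class G x) = F x"
proof -
  have F: "F \<in> hom G plus_group" by (rule homI) (simp_all add: add)
  have F1: "F \<one> = 0" using add[of \<one> \<one>] by simp
  have Finv: "F (inv x) = - F x" if "x \<in> carrier G" for x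
    using add[of "inv x" x] that F1 by (simp add: eq_neg_iff_add_eq_0)
  have D: "generate G (derived_set G (carrier G)) \<lhd> G"
    using derived_self_is_normal by (simp add: derived_def)
  obtain k where k: "k \<in> hom (abelianization G) plus_group"
    and kF: "\<And>x. x \<in> carrier G \<Longrightarrow> k (ab_class G x) = F x"
    by (rule hom_factors_through_Mod[OF is_group group_plus_group F D])
      (auto simp: add Finv abelianization_def ab_class_def derived_def)
  interpret A: group "abelianization G" by (rule abelianization_group)
  show thesis
  proof
    \<comment> \<open>Elements of \<open>ab_Hom\<close> are extensional, hence the
      restriction.\<close>
    show "restrict k (carrier (abelianization G)) \<in> ab_Hom G"
      using k by (auto simp: ab_Hom_def hom_def)
  qed (simp add: ab_class_in_carrier kF)
qed

text \<open>Bounds add along products, and an inverse inherits the bound of its generator after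
  shifting the base point.\<close>

lemma bounded_differences_generate:
  fixes f :: "'a \<Rightarrow> complex"
  assumes S: "S \<subseteq> carrier G"
    and bd: "\<And>s. s \<in> S \<Longrightarrow> \<exists>K. \<forall>x\<in>carrier G. cmod (f (x \<otimes> s) - f x) \<le> K"
    and g: "g \<in> generate G S"
  shows "\<exists>K. \<forall>x\<in>carrier G. cmod (f (x \<otimes> g) - f x) \<le> K"
  using g
proof (induction rule: generate.induct)
  case one
  then show ?case by (intro exI[of _ 0]) simp
next
  case (incl h)
  then show ?case by (rule bd)
next
  case (inv h)
  obtain K where K: "\<And>x. x \<in> carrier G \<Longrightarrow> cmod (f (x \<otimes> h) - f x) \<le> K"
    using bd[OF inv] by blast
  have "h \<in> carrier G" using inv S by blast
  then have "cmod (f (x \<otimes> inv h) - f x) \<le> K" if "x \<in> carrier G" for x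
    using K[of "x \<otimes> inv h"] that by (simp add: m_assoc norm_minus_commute)
  then show ?case by blast
next
  case (eng h1 h2)
  then obtain K L where K: "\<And>x. x \<in> carrier G \<Longrightarrow> cmod (f (x \<otimes> h1) - f x) \<le> K"
    and L: "\<And>x. x \<in> carrier G \<Longrightarrow> cmod (f (x \<otimes> h2) - f x) \<le> L" by blast
  have h: "h1 \<in> carrier G" "h2 \<in> carrier G" using eng S generate_in_carrier by auto
  have "cmod (f (x \<otimes> (h1 \<otimes> h2)) - f x) \<le> L + K" if x: "x \<in> carrier G" for x
    using norm_diff_triangle_le[OF L[of "x \<otimes> h1"] K[OF x]] x h by (simp add: m_assoc)
  then show ?case by blast
qed

end

subsection \<open>Lipschitz harmonic functions are affine\<close>

lemma cmod_partial_diff_le: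
  assumes "grad_norm G S f < \<infinity>" "s \<in> S" "x \<in> carrier G"
  shows "cmod (partial_diff G s f x) \<le> enn2real (grad_norm G S f)"
proof -
  have "ennreal (cmod (partial_diff G s f x)) \<le> grad_norm G S f"
    unfolding grad_norm_def by (rule SUP_upper2[OF assms(2)], rule SUP_upper[OF assms(3)])
  also have "\<dots> = ennreal (enn2real (grad_norm G S f))"
    using assms(1) by simp
  finally show ?thesis by simp
qed

text \<open>The real and imaginary parts are affine by the descent, so \<open>f x - f \<one>\<close>
  is additive in \<open>x\<close> and factors through the abelianization.\<close>

lemma (in adapted_walk) LHF_affine:
  assumes gen: "S \<subseteq> carrier G" "generate G S = carrier G"
    and nil: "lower_central G n = {\<one>}" and f: "f \<in> LHF G S \<mu>"
  obtains \<phi> where "\<phi> \<in> ab_Hom G" "\<And>x. x \<in> carrier G \<Longrightarrow> f x = \<phi> (ab_class G x) + f \<one>"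
proof -
  have gr: "grad_norm G S f < \<infinity>" and harm: "harmonic G \<mu> f"
    using f by (auto simp: LHF_def)
  have "\<exists>K. \<forall>x\<in>carrier G. cmod (f (x \<otimes> g) - f x) \<le> K" if "g \<in> carrier G" for g
    using bounded_differences_generate[OF gen(1), of f g] cmod_partial_diff_le[OF gr]
      that gen(2) unfolding partial_diff_def by blast
  then have bd: "bounded_differences (\<lambda>x. Re (f x))" "bounded_differences (\<lambda>x. Im (f x))"
    unfolding bounded_differences_def
    using abs_Re_le_cmod abs_Im_le_cmod order_trans minus_complex.sel by metis+
  have sum: "((\<lambda>g. of_real (pmf \<mu> g) * f (k \<otimes> g)) has_sum f k) (carrier G)"
    if "k \<in> carrier G" for k
  proof -
    have "(\<lambda>g. of_real (pmf \<mu> g) * f (k \<otimes> g)) summable_on carrier G"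
      using harm that by (simp add: harmonic_def summable_on_iff_abs_summable_on_complex)
    then show ?thesis using harm that by (simp add: harmonic_def has_sum_iff)
  qed
  then have "real_harmonic (\<lambda>x. Re (f x))" "real_harmonic (\<lambda>x. Im (f x))"
    unfolding real_harmonic_def using has_sum_Re[OF sum] has_sum_Im[OF sum] by auto
  from real_harmonic_affine[OF this(1) bd(1) nil] real_harmonic_affine[OF this(2) bd(2) nil]
  have "f (x \<otimes> y) - f \<one> = (f x - f \<one>) + (f y - f \<one>)" if "x \<in> carrier G" "y \<in> carrier G" for x y
    using that by (simp add: complex_eq_iff algebra_simps)
  then obtain \<phi> where "\<phi> \<in> ab_Hom G" "\<And>x. x \<in> carrier G \<Longrightarrow> \<phi> (ab_class G x) = f x - f \<one>"
    using hom_factors_through_abelianization[of "\<lambda>x. f x - f \<one>"] by blast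
  then show thesis using that by simp
qed

text \<open>The difference in direction \<open>s\<close> is the same at every point, so the inner
  supremum collapses. The constant \<open>c\<close> lets this cover pullbacks and arbitrary
  Lipschitz harmonic functions alike.\<close>

lemma (in group) grad_norm_hom:
  assumes S: "finite S" "S \<subseteq> carrier G" and \<phi>: "\<phi> \<in> ab_Hom G"
    and f: "\<And>x. x \<in> carrier G \<Longrightarrow> f x = \<phi> (ab_class G x) + c"
  shows "grad_norm G S f = ennreal (hom_norm G S \<phi>)"
proof -
  have hom: "\<phi> \<in> hom (abelianization G) plus_group" using \<phi> by (simp add: ab_Hom_def)
  have "partial_diff G s f x = \<phi> (ab_class G s)" if "s \<in> S" "x \<in> carrier G" for s x
    using that S by (auto simp: partial_diff_def f ab_hom_mult[OF hom])
  then have gr: "grad_norm G S f = (SUP s\<in>S. ennreal (cmod (\<phi> (ab_class G s))))"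
    unfolding grad_norm_def using one_closed by (intro SUP_cong) (auto simp: SUP_constant)
  let ?M = "insert 0 ((\<lambda>s. cmod (\<phi> (ab_class G s))) ` S)"
  have fin: "finite ?M" using S by simp
  show ?thesis
  proof (rule antisym)
    show "grad_norm G S f \<le> ennreal (hom_norm G S \<phi>)"
      unfolding gr hom_norm_def using Max_ge[OF fin] by (intro SUP_least ennreal_leI) auto
    \<comment> \<open>The maximum is either the inserted \<open>0\<close>, as for empty
      \<open>S\<close>, or the value at some generator.\<close>
    show "ennreal (hom_norm G S \<phi>) \<le> grad_norm G S f"
      using Max_in[OF fin] unfolding gr hom_norm_def by (auto intro: SUP_upper)
  qed
qed

text \<open>The average of \<open>\<phi>\<close> over the classes of \<open>k \<otimes> g\<close>
  splits into the value at \<open>k\<close>, as the total mass is 1, and the mean of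
  \<open>\<phi>\<close> under \<mu>, which centering makes 0.\<close>

lemma (in adapted_walk) hom_pullback_LHF:
  assumes S: "finite S" "S \<subseteq> carrier G" and cent: "abelian_centered G \<mu>" and \<phi>: "\<phi> \<in> ab_Hom G"
  shows "hom_pullback G \<phi> \<in> LHF G S \<mu>"
proof -
  have hom: "\<phi> \<in> hom (abelianization G) plus_group" using \<phi> by (simp add: ab_Hom_def)
  have "grad_norm G S (hom_pullback G \<phi>) = ennreal (hom_norm G S \<phi>)"
    by (rule grad_norm_hom[OF S \<phi>, of _ 0]) (simp add: hom_pullback_def)
  moreover have "harmonic G \<mu> (hom_pullback G \<phi>)"
    unfolding harmonic_def
  proof
    fix k assume k: "k \<in> carrier G"
    have "((\<lambda>g. of_real (pmf \<mu> g) * \<phi> (ab_class G k) + of_real (pmf \<mu> g) * \<phi> (ab_class G g))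
        has_sum \<phi> (ab_class G k)) (carrier G)"
      using has_sum_add[OF has_sum_cmult_left[OF has_sum_of_real[OF pmf_has_sum_1[OF supp]]]
          abelian_centered_has_sum_complex[OF cent hom], of "\<phi> (ab_class G k)"] by simp
    then have "((\<lambda>g. of_real (pmf \<mu> g) * hom_pullback G \<phi> (k \<otimes> g)) has_sum \<phi> (ab_class G k))
        (carrier G)"
      using k by (simp add: hom_pullback_def ab_hom_mult[OF hom] distrib_left cong: has_sum_cong)
    moreover have "hom_pullback G \<phi> k = \<phi> (ab_class G k)" using k by (simp add: hom_pullback_def)
    ultimately show "(\<lambda>g. cmod (of_real (pmf \<mu> g) * hom_pullback G \<phi> (k \<otimes> g))) summable_on carrier G \<and>
        hom_pullback G \<phi> k = (\<Sum>\<^sub>\<infinity>g\<in>carrier G. of_real (pmf \<mu> g) * hom_pullback G \<phi> (k \<otimes> g))"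
      using summable_on_iff_abs_summable_on_complex[THEN iffD1, OF has_sum_imp_summable]
      by (auto simp: infsumI)
  qed
  ultimately show ?thesis by (simp add: LHF_def hom_pullback_def)
qed

section \<open>Classes modulo constants and the map \<open>Theta\<close>\<close>

lemma LHF_class_cong:
  assumes "\<And>x. x \<in> carrier G \<Longrightarrow> f x = g x + c"
  shows "LHF_class G S \<mu> f = LHF_class G S \<mu> g"
proof -
  have "(\<exists>d. \<forall>x\<in>carrier G. h x = f x + d) \<longleftrightarrow> (\<exists>d. \<forall>x\<in>carrier G. h x = g x + d)" for h
  proof
    assume "\<exists>d. \<forall>x\<in>carrier G. h x = f x + d"
    then obtain d where "\<forall>x\<in>carrier G. h x = f x + d" by blast
    then show "\<exists>d. \<forall>x\<in>carrier G. h x = g x + d"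
      using assms by (intro exI[of _ "c + d"]) auto
  next
    assume "\<exists>d. \<forall>x\<in>carrier G. h x = g x + d"
    then obtain d where "\<forall>x\<in>carrier G. h x = g x + d" by blast
    then show "\<exists>d. \<forall>x\<in>carrier G. h x = f x + d"
      using assms by (intro exI[of _ "d - c"]) auto
  qed
  then show ?thesis by (simp add: LHF_class_def)
qed

text \<open>Agreement passes from generators to products and inverses; this gives the uniqueness
  behind \<open>Theta\<close>.\<close>

lemma (in group) ab_Hom_eqI:
  assumes S: "S \<subseteq> carrier G" "generate G S = carrier G"
    and \<phi>: "\<phi> \<in> ab_Hom G" and \<psi>: "\<psi> \<in> ab_Hom G"
    and eq: "\<And>s. s \<in> S \<Longrightarrow> \<phi> (ab_class G s) = \<psi> (ab_class G s)"
  shows "\<phi> = \<psi>"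
proof (rule extensionalityI[of _ "carrier (abelianization G)"])
  have hom: "\<phi> \<in> hom (abelianization G) plus_group" "\<psi> \<in> hom (abelianization G) plus_group"
    using \<phi> \<psi> by (auto simp: ab_Hom_def)
  have "\<phi> (ab_class G x) = \<psi> (ab_class G x)" if "x \<in> generate G S" for x
    using that
  proof (induction rule: generate.induct)
    case one
    show ?case by (simp add: ab_hom_one[OF hom(1)] ab_hom_one[OF hom(2)])
  next
    case (inv h)
    then show ?case using S eq by (auto simp: ab_hom_inv[OF hom(1)] ab_hom_inv[OF hom(2)])
  next
    case (eng h1 h2)
    then show ?case using S(2) by (simp add: ab_hom_mult[OF hom(1)] ab_hom_mult[OF hom(2)])
  qed (rule eq)
  then show "\<phi> a = \<psi> a" if "a \<in> carrier (abelianization G)" for a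
    using that S(2) by (auto simp: carrier_abelianization)
qed (use \<phi> \<psi> in \<open>auto simp: ab_Hom_def\<close>)

theorem theorem2:
  fixes G :: "('a, 'b) monoid_scheme" and S :: "'a set" and \<mu> :: "'a pmf"
  assumes "nilpotent_group G"
    and "finite_symmetric_generating_set G S"
    and "set_pmf \<mu> \<subseteq> carrier G"
    and "adapted G \<mu>"
    and "smooth_measure G S \<mu>"
    and "abelian_centered G \<mu>"
  shows
    "(\<forall>C\<in>LHF_mod_const G S \<mu>. \<exists>!\<phi>. is_Theta_value G S C \<phi>) \<and>
     (\<forall>C\<in>LHF_mod_const G S \<mu>. \<forall>D\<in>LHF_mod_const G S \<mu>.
        class_add G S \<mu> C D \<in> LHF_mod_const G S \<mu> \<and>
        Theta G S (class_add G S \<mu> C D) =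
          fun_add (carrier (abelianization G)) (Theta G S C) (Theta G S D)) \<and>
     (\<forall>c. \<forall>C\<in>LHF_mod_const G S \<mu>.
        class_scale G S \<mu> c C \<in> LHF_mod_const G S \<mu> \<and>
        Theta G S (class_scale G S \<mu> c C) =
          fun_scale (carrier (abelianization G)) c (Theta G S C)) \<and>
     (\<forall>f\<in>LHF G S \<mu>.
        grad_norm G S f = ennreal (hom_norm G S (Theta G S (LHF_class G S \<mu> f)))) \<and>
     bij_betw (Theta G S) (LHF_mod_const G S \<mu>) (ab_Hom G) \<and>
     (\<forall>\<phi>\<in>ab_Hom G. hom_pullback G \<phi> \<in> LHF G S \<mu> \<and>
        inv_into (LHF_mod_const G S \<mu>) (Theta G S) \<phi> = LHF_class G S \<mu> (hom_pullback G \<phi>))"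
proof -
  obtain n where "group G" and nil: "lower_central G n = {\<one>\<^bsub>G\<^esub>}"
    using assms(1) by (auto simp: nilpotent_group_def)
  interpret group G by fact
  interpret adapted_walk G \<mu> by unfold_locales (use assms in auto)
  interpret A: group "abelianization G" by (rule abelianization_group)
  have S: "finite S" "S \<subseteq> carrier G" "generate G S = carrier G"
    using assms(2) by (auto simp: finite_symmetric_generating_set_def)
  let ?L = "LHF_mod_const G S \<mu>" and ?A = "carrier (abelianization G)"
  \<comment> \<open>The candidate inverse of \<open>Theta\<close>. Once it is known to parametrize
    the quotient, all claims reduce to computations with homomorphisms.\<close>
  define cls where "cls \<phi> = LHF_class G S \<mu> (hom_pullback G \<phi>)" for \<phi>

  have pullback: "hom_pullback G \<phi> \<in> LHF G S \<mu>" if "\<phi> \<in> ab_Hom G" for \<phi>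
    using hom_pullback_LHF[OF S(1,2) assms(6) that] .
  have class_eq: "LHF_class G S \<mu> f = cls \<phi>"
    if "\<And>x. x \<in> carrier G \<Longrightarrow> f x = \<phi> (ab_class G x) + c" for f \<phi> c
    unfolding cls_def using that by (intro LHF_class_cong[of _ _ _ c]) (simp add: hom_pullback_def)
  have cls_iff: "f \<in> cls \<phi> \<longleftrightarrow>
      f \<in> LHF G S \<mu> \<and> (\<exists>c. \<forall>x\<in>carrier G. f x = \<phi> (ab_class G x) + c)" for f \<phi>
    by (auto simp: cls_def LHF_class_def hom_pullback_def)
  have pullback_cls: "hom_pullback G \<phi> \<in> cls \<phi>" if "\<phi> \<in> ab_Hom G" for \<phi>
    using pullback[OF that] by (auto simp: cls_iff hom_pullback_def intro!: exI[of _ 0])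
  \<comment> \<open>One inclusion is affineness, the other the harmonicity of pullbacks.\<close>
  have LHF_mod_const: "?L = cls ` ab_Hom G"
  proof
    show "?L \<subseteq> cls ` ab_Hom G"
    proof
      fix C assume "C \<in> ?L"
      then obtain f where f: "f \<in> LHF G S \<mu>" "C = LHF_class G S \<mu> f"
        by (auto simp: LHF_mod_const_def)
      obtain \<phi> where "\<phi> \<in> ab_Hom G" "\<And>x. x \<in> carrier G \<Longrightarrow> f x = \<phi> (ab_class G x) + f \<one>\<^bsub>G\<^esub>"
        using LHF_affine[OF S(2,3) nil f(1)] by blast
      then show "C \<in> cls ` ab_Hom G" using class_eq f(2) by blast
    qed
    show "cls ` ab_Hom G \<subseteq> ?L"
      using pullback by (auto simp: LHF_mod_const_def cls_def)
  qed
  \<comment> \<open>The pullback shows that the class is nonempty, so the condition on its members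
    really determines the value on \<open>S\<close>.\<close>
  have Theta_value: "is_Theta_value G S (cls \<phi>) \<psi> \<longleftrightarrow> \<psi> = \<phi>" if \<phi>: "\<phi> \<in> ab_Hom G" for \<phi> \<psi>
  proof
    have one: "\<phi> (ab_class G \<one>\<^bsub>G\<^esub>) = 0" using \<phi> ab_hom_one by (auto simp: ab_Hom_def)
    have diff: "partial_diff G s f \<one>\<^bsub>G\<^esub> = \<phi> (ab_class G s)" if "f \<in> cls \<phi>" "s \<in> S" for f s
    proof -
      obtain c where "\<forall>x\<in>carrier G. f x = \<phi> (ab_class G x) + c"
        using \<open>f \<in> cls \<phi>\<close> by (auto simp: cls_iff)
      then show ?thesis using S(2) \<open>s \<in> S\<close> one by (auto simp: partial_diff_def)
    qed
    show "is_Theta_value G S (cls \<phi>) \<psi>" if "\<psi> = \<phi>"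
      using \<phi> diff that by (simp add: is_Theta_value_def)
    assume \<psi>: "is_Theta_value G S (cls \<phi>) \<psi>"
    then have "\<psi> \<in> ab_Hom G" by (simp add: is_Theta_value_def)
    then show "\<psi> = \<phi>"
      using \<psi> diff[OF pullback_cls[OF \<phi>]] pullback_cls[OF \<phi>]
      by (intro ab_Hom_eqI[OF S(2,3) _ \<phi>]) (auto simp: is_Theta_value_def)
  qed
  then have Theta_cls: "Theta G S (cls \<phi>) = \<phi>" if "\<phi> \<in> ab_Hom G" for \<phi>
    using that by (simp add: Theta_def)

  have add_Hom: "fun_add ?A \<phi> \<psi> \<in> ab_Hom G" if "\<phi> \<in> ab_Hom G" "\<psi> \<in> ab_Hom G" for \<phi> \<psi>
    using that by (auto simp: ab_Hom_def hom_def fun_add_def)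
  have scale_Hom: "fun_scale ?A c \<phi> \<in> ab_Hom G" if "\<phi> \<in> ab_Hom G" for c \<phi>
    using that by (auto simp: ab_Hom_def hom_def fun_scale_def distrib_left)
  have add_cls: "class_add G S \<mu> (cls \<phi>) (cls \<psi>) = cls (fun_add ?A \<phi> \<psi>)"
    if \<phi>: "\<phi> \<in> ab_Hom G" and \<psi>: "\<psi> \<in> ab_Hom G" for \<phi> \<psi>
  proof -
    have "LHF_class G S \<mu> (fun_add (carrier G) f g) = cls (fun_add ?A \<phi> \<psi>)"
      if fg: "f \<in> cls \<phi>" "g \<in> cls \<psi>" for f g
    proof -
      obtain c d where "\<forall>x\<in>carrier G. f x = \<phi> (ab_class G x) + c"
        "\<forall>x\<in>carrier G. g x = \<psi> (ab_class G x) + d"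
        using fg by (auto simp: cls_iff)
      then show ?thesis
        by (intro class_eq[of _ _ "c + d"]) (simp add: fun_add_def ab_class_in_carrier)
    qed
    \<comment> \<open>The union runs over a nonempty family of equal classes.\<close>
    then show ?thesis
      using pullback_cls[OF \<phi>] pullback_cls[OF \<psi>] unfolding class_add_def by blast
  qed
  have scale_cls: "class_scale G S \<mu> c (cls \<phi>) = cls (fun_scale ?A c \<phi>)"
    if \<phi>: "\<phi> \<in> ab_Hom G" for c \<phi>
  proof -
    have "LHF_class G S \<mu> (fun_scale (carrier G) c f) = cls (fun_scale ?A c \<phi>)"
      if f: "f \<in> cls \<phi>" for f
    proof -
      obtain d where "\<forall>x\<in>carrier G. f x = \<phi> (ab_class G x) + d"
        using f by (auto simp: cls_iff)
      then show ?thesis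
        by (intro class_eq[of _ _ "c * d"])
          (simp add: fun_scale_def ab_class_in_carrier distrib_left)
    qed
    then show ?thesis
      using pullback_cls[OF \<phi>] unfolding class_scale_def by blast
  qed
  have inj: "inj_on (Theta G S) ?L"
    unfolding LHF_mod_const by (auto simp: inj_on_def Theta_cls)
  have "grad_norm G S f = ennreal (hom_norm G S (Theta G S (LHF_class G S \<mu> f)))"
    if f: "f \<in> LHF G S \<mu>" for f
  proof -
    obtain \<phi> where \<phi>: "\<phi> \<in> ab_Hom G"
      and f\<phi>: "\<And>x. x \<in> carrier G \<Longrightarrow> f x = \<phi> (ab_class G x) + f \<one>\<^bsub>G\<^esub>"
      using LHF_affine[OF S(2,3) nil f] by blast
    then show ?thesis
      using grad_norm_hom[OF S(1,2) \<phi> f\<phi>] class_eq[of f \<phi>, OF f\<phi>] by (simp add: Theta_cls)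
  qed
  moreover have "bij_betw (Theta G S) ?L (ab_Hom G)"
    using inj by (simp add: bij_betw_def LHF_mod_const image_image Theta_cls)
  moreover have "inv_into ?L (Theta G S) \<phi> = LHF_class G S \<mu> (hom_pullback G \<phi>)"
    if "\<phi> \<in> ab_Hom G" for \<phi>
    using that by (intro inv_into_f_eq[OF inj])
      (auto simp: LHF_mod_const Theta_cls simp flip: cls_def)
  ultimately show ?thesis
    using pullback
    by (auto simp: LHF_mod_const Theta_value Theta_cls add_cls scale_cls add_Hom scale_Hom)
qed

end
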